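(* For all $n\geq 1$, $c_n(11\text{-}1)=c_n(1\text{-}11)$. Moreover, the refinements of $c_n(11\text{-}1)$ according to the largest letter or the last letter coincide with those of $c_n(1\text{-}11)$; that is, for every $k\ge1$, the number of members of $\mathcal{C}_n(11\text{-}1)$ with largest letter $k$ equals the number of members of $\mathcal{C}_n(1\text{-}11)$ with largest letter $k$, and the number of members of $\mathcal{C}_n(11\text{-}1)$ with last letter $k$ equals the number of members of $\mathcal{C}_n(1\text{-}11)$ with last letter $k$.
   Context: A Catalan word of length $n\ge 1$ is a sequence $\pi=\pi_1\cdots\pi_n$ of positive integers with $\pi_1=1$ and $\pi_{i+1}\le \pi_i+1$ for $1\le i\le n-1$; $\mathcal{C}_n$ is the set of these. A word $\pi$ contains the vincular pattern $11\text{-}1$ if there are indices $i,j$ with $i+1<j\le n$ such that $\pi_i=\pi_{i+1}=\pi_j$, and contains $1\text{-}11$ if there are indices $i<j$ with $j+1\le n$ such that $\pi_i=\pi_j=\pi_{j+1}$; otherwise it avoids the respective pattern. $\mathcal{C}_n(\tau)$ is the set of members of $\mathcal{C}_n$ avoiding $\tau$, and $c_n(\tau)=|\mathcal{C}_n(\tau)|$. *)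

theory Defs
  imports Main
begin

text \<open>
  Words are lists of natural numbers. List positions start at 0, so the letter \<open>\<pi>\<^sub>i\<close>
  of the paper is \<open>w ! (i - 1)\<close>.
\<close>

definition catalan_word :: "nat list \<Rightarrow> bool" where
  "catalan_word w \<longleftrightarrow>
     w \<noteq> [] \<and> (\<forall>x \<in> set w. 1 \<le> x) \<and> w ! 0 = 1 \<and>
     (\<forall>i. i + 1 < length w \<longrightarrow> w ! (i + 1) \<le> w ! i + 1)"

definition catalan_words :: "nat \<Rightarrow> nat list set" where
  "catalan_words n = {w. length w = n \<and> catalan_word w}"

definition contains_11_1 :: "nat list \<Rightarrow> bool" where
  "contains_11_1 w \<longleftrightarrow>
     (\<exists>i j. i + 1 < j \<and> j < length w \<and> w ! i = w ! (i + 1) \<and> w ! (i + 1) = w ! j)"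

definition contains_1_11 :: "nat list \<Rightarrow> bool" where
  "contains_1_11 w \<longleftrightarrow>
     (\<exists>i j. i < j \<and> j + 1 < length w \<and> w ! i = w ! j \<and> w ! j = w ! (j + 1))"

text \<open>A pattern is represented by its containment predicate.\<close>

definition catalan_avoiding :: "(nat list \<Rightarrow> bool) \<Rightarrow> nat \<Rightarrow> nat list set" where
  "catalan_avoiding contains n = {w \<in> catalan_words n. \<not> contains w}"

definition catalan_count :: "(nat list \<Rightarrow> bool) \<Rightarrow> nat \<Rightarrow> nat" where
  "catalan_count contains n = card (catalan_avoiding contains n)"

text \<open>All these sets are finite, so that \<open>card\<close> has its intended meaning on them.\<close>

lemma catalan_word_nth_le: "catalan_word w \<Longrightarrow> i < length w \<Longrightarrow> w ! i \<le> i + 1"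
proof (induction i)
  case (Suc i)
  then have "w ! (i + 1) \<le> w ! i + 1" by (simp add: catalan_word_def)
  with Suc show ?case by simp
qed (simp add: catalan_word_def)

lemma finite_catalan_words: "finite (catalan_words n)"
proof (rule finite_subset)
  show "catalan_words n \<subseteq> {w. set w \<subseteq> {..n} \<and> length w = n}"
    using catalan_word_nth_le by (fastforce simp: catalan_words_def in_set_conv_nth)
  show "finite {w. set w \<subseteq> {..n} \<and> length w = n}"
    by (rule finite_lists_length_eq) simp
qed

lemma finite_catalan_avoiding: "finite (catalan_avoiding contains n)"
  by (simp add: catalan_avoiding_def finite_catalan_words)

end

theory Submission
  imports Defs
begin

text \<open>
  Cut a word into its maximal runs of equal letters. It avoids \<open>11-1\<close> exactly when, for every
  letter, all runs of that letter have length 1 except possibly its last run, which may have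
  length 2; it avoids \<open>1-11\<close> exactly when the same holds with "first run" for "last run". So in
  both cases the word is determined by two independent pieces of data: the word
  \<^term>\<open>remdups_adj w\<close> obtained by shrinking every run to one letter, and the set of letters that
  occur doubled. Moving each doubling from the last run of its letter to the first run is
  therefore a bijection between the two classes.

  The bijection keeps \<^term>\<open>remdups_adj w\<close>, and this word already determines the largest letter
  and the last letter of \<open>w\<close> and whether \<open>w\<close> is a Catalan word. The length is kept because it
  equals the length of the shrunk word plus the number of doubled letters. Since reversal
  exchanges the two patterns, the analysis of runs is only carried out for \<open>11-1\<close>, on arbitrary
  words (\<open>double_last_shrink\<close>, \<open>remdups_adj_double_last\<close>, \<open>doubled_double_last\<close>).
\<close>

definition doubled :: "'a list \<Rightarrow> 'a set" where
  "doubled w = {x. \<exists>us vs. w = us @ x # x # vs}"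

fun double_last :: "'a set \<Rightarrow> 'a list \<Rightarrow> 'a list" where
  "double_last S [] = []"
| "double_last S (x # u) =
     (if x \<in> S \<and> x \<notin> set u then x # x # double_last S u else x # double_last S u)"

text \<open>
  These two maps send a word to a normal form for the relation of having the same shrunk word and
  the same doubled letters: the one that avoids \<open>11-1\<close> and the one that avoids \<open>1-11\<close>.
\<close>

definition doublings_last :: "'a list \<Rightarrow> 'a list" where
  "doublings_last w = double_last (doubled w) (remdups_adj w)"

definition doublings_first :: "'a list \<Rightarrow> 'a list" where
  "doublings_first w = rev (doublings_last (rev w))"


section \<open>Doubled letters and the two patterns\<close>

lemma doubled_simps [simp]:
  "doubled [] = {}"
  "doubled [x] = {}"
  "doubled (x # y # w) = (if x = y then {x} else {}) \<union> doubled (y # w)"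
  by (auto simp: doubled_def Cons_eq_append_conv)

lemma doubled_subset_set: "doubled w \<subseteq> set w"
  by (auto simp: doubled_def)

lemma doubled_Cons_subset: "doubled (x # w) \<subseteq> set w"
  by (auto simp: doubled_def Cons_eq_append_conv)

lemma doubled_rev [simp]: "doubled (rev w) = doubled w"
proof -
  have "doubled w \<subseteq> doubled (rev w)" for w :: "'a list"
  proof
    fix x assume "x \<in> doubled w"
    then obtain us vs where "w = us @ x # x # vs" by (auto simp: doubled_def)
    then have "rev w = rev vs @ x # x # rev us" by simp
    then show "x \<in> doubled (rev w)" unfolding doubled_def by blast
  qed
  from this[of w] this[of "rev w"] show ?thesis by auto
qed

lemma contains_11_1_iff_append:
  "contains_11_1 w \<longleftrightarrow> (\<exists>us x vs. w = us @ x # x # vs \<and> x \<in> set vs)"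
proof
  assume "contains_11_1 w"
  then obtain i j where ij: "i + 1 < j" "j < length w" "w ! i = w ! (i + 1)" "w ! (i + 1) = w ! j"
    unfolding contains_11_1_def by blast
  define x where "x = w ! i"
  have "w = take i w @ w ! i # drop (Suc i) w"
    using ij by (intro id_take_nth_drop) simp
  also have "drop (Suc i) w = w ! Suc i # drop (Suc (Suc i)) w"
    using ij by (intro Cons_nth_drop_Suc[symmetric]) simp
  finally have split: "w = take i w @ x # x # drop (i + 2) w"
    using ij by (simp add: x_def)
  have "i + 2 + (j - (i + 2)) = j" using ij by simp
  then have "drop (i + 2) w ! (j - (i + 2)) = x" "j - (i + 2) < length (drop (i + 2) w)"
    using ij by (simp_all only: x_def nth_drop length_drop)
  then have "x \<in> set (drop (i + 2) w)" by (metis nth_mem)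
  with split show "\<exists>us x vs. w = us @ x # x # vs \<and> x \<in> set vs" by blast
next
  assume "\<exists>us x vs. w = us @ x # x # vs \<and> x \<in> set vs"
  then obtain us x vs where w: "w = us @ x # x # vs" and "x \<in> set vs" by blast
  then obtain k where "k < length vs" "vs ! k = x" by (auto simp: in_set_conv_nth)
  with w show "contains_11_1 w"
    unfolding contains_11_1_def
    by (intro exI[of _ "length us"] exI[of _ "length us + k + 2"]) (auto simp: nth_append)
qed

lemma contains_11_1_Cons:
  "contains_11_1 (x # w) \<longleftrightarrow> (\<exists>vs. w = x # vs \<and> x \<in> set vs) \<or> contains_11_1 w"
  unfolding contains_11_1_iff_append Cons_eq_append_conv by blast

lemma contains_11_1_simps [simp]:
  "\<not> contains_11_1 []"
  "\<not> contains_11_1 [x]"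
  "contains_11_1 (x # y # w) \<longleftrightarrow> (x = y \<and> x \<in> set w) \<or> contains_11_1 (y # w)"
  using contains_11_1_Cons[of x "y # w"] contains_11_1_Cons[of x "[]"]
  by (auto simp: contains_11_1_iff_append)

lemma contains_11_1_rev: "contains_11_1 (rev w) \<longleftrightarrow> contains_1_11 w"
proof
  assume "contains_11_1 (rev w)"
  then obtain i j where "i + 1 < j" "j < length w"
    "rev w ! i = rev w ! (i + 1)" "rev w ! (i + 1) = rev w ! j"
    unfolding contains_11_1_def by auto
  then show "contains_1_11 w"
    unfolding contains_1_11_def
    by (intro exI[of _ "length w - 1 - j"] exI[of _ "length w - 2 - i"])
      (auto simp: rev_nth Suc_diff_Suc numeral_2_eq_2)
next
  assume "contains_1_11 w"
  then obtain i j where "i < j" "j + 1 < length w" "w ! i = w ! j" "w ! j = w ! (j + 1)"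
    unfolding contains_1_11_def by auto
  then show "contains_11_1 (rev w)"
    unfolding contains_11_1_def
    by (intro exI[of _ "length w - 2 - j"] exI[of _ "length w - 1 - i"])
      (auto simp: rev_nth Suc_diff_Suc numeral_2_eq_2)
qed


section \<open>Avoiders are shrunk words with some last occurrences doubled\<close>

lemma set_double_last [simp]: "set (double_last S u) = set u"
  by (induction u) auto

lemma double_last_cong: "S \<inter> set u = T \<inter> set u \<Longrightarrow> double_last S u = double_last T u"
  by (induction u) auto

lemma length_double_last: "length (double_last S u) = length u + card (S \<inter> set u)"
proof (induction u)
  case (Cons x u)
  then show ?case
    by (cases "x \<in> S"; cases "x \<in> set u") (auto simp: insert_absorb)
qed simp

lemma double_last_Cons_obtains:
  obtains v where "double_last S (x # u) = x # v"
  by (cases "x \<in> S \<and> x \<notin> set u") auto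

lemma remdups_adj_double_last: "distinct_adj u \<Longrightarrow> remdups_adj (double_last S u) = u"
proof (induction u rule: remdups_adj.induct)
  case (3 x y u)
  obtain v where "double_last S (y # u) = y # v" by (rule double_last_Cons_obtains)
  with 3 show ?case by (subst double_last.simps) (auto simp del: double_last.simps)
qed auto

lemma doubled_double_last: "distinct_adj u \<Longrightarrow> doubled (double_last S u) = S \<inter> set u"
proof (induction u rule: remdups_adj.induct)
  case (3 x y u)
  obtain v where "double_last S (y # u) = y # v" by (rule double_last_Cons_obtains)
  with 3 show ?case by (subst double_last.simps) (auto simp del: double_last.simps)
qed auto

lemma double_last_avoids_11_1: "distinct_adj u \<Longrightarrow> \<not> contains_11_1 (double_last S u)"
proof (induction u rule: remdups_adj.induct)
  case (3 x y u)
  obtain v where v: "double_last S (y # u) = y # v" by (rule double_last_Cons_obtains)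
  have "set (y # v) = set (y # u)" by (metis v set_double_last)
  with 3 v show ?case by (subst double_last.simps) (auto simp del: double_last.simps)
qed auto

lemma double_last_shrink:
  "\<not> contains_11_1 w \<Longrightarrow> double_last (doubled w) (remdups_adj w) = w"
proof (induction w rule: remdups_adj.induct)
  case (3 x y w)
  show ?case
  proof (cases "x = y")
    case True
    \<comment> \<open>The doubled letter does not return, so here the run in front is the last one of its letter.\<close>
    with 3 have x: "x \<notin> set w" and IH: "double_last (doubled (x # w)) (remdups_adj (x # w)) = x # w"
      by auto
    have shrink: "remdups_adj (x # w) = x # remdups_adj w"
      using x by (cases w) auto
    have "x \<notin> doubled (x # w)" using x doubled_Cons_subset[of x w] by auto
    with IH shrink have "double_last (doubled (x # w)) (remdups_adj w) = w" by auto
    moreover have "double_last (insert x (doubled (x # w))) (remdups_adj w)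
        = double_last (doubled (x # w)) (remdups_adj w)"
      using x by (intro double_last_cong) auto
    ultimately show ?thesis using True x shrink by simp
  next
    case False
    have "x \<notin> doubled (y # w) \<or> x \<in> set w" using doubled_Cons_subset[of y w] by auto
    with 3 False show ?thesis by auto
  qed
qed auto


section \<open>Moving the doublings\<close>

lemma remdups_adj_doublings [simp]:
  "remdups_adj (doublings_last w) = remdups_adj w"
  "remdups_adj (doublings_first w) = remdups_adj w"
  by (simp_all add: doublings_last_def doublings_first_def remdups_adj_double_last remdups_adj_rev)

lemma doubled_doublings [simp]:
  "doubled (doublings_last w) = doubled w"
  "doubled (doublings_first w) = doubled w"
  using doubled_subset_set[of w]
  by (auto simp: doublings_last_def doublings_first_def doubled_double_last)

lemma length_doublings:
  "length (doublings_last w) = length (remdups_adj w) + card (doubled w)"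
  "length (doublings_first w) = length (remdups_adj w) + card (doubled w)"
  using doubled_subset_set[of w]
  by (simp_all add: doublings_last_def doublings_first_def length_double_last remdups_adj_rev
      Int_absorb2)

lemma doublings_avoid:
  "\<not> contains_11_1 (doublings_last w)"
  "\<not> contains_1_11 (doublings_first w)"
  by (simp_all add: doublings_last_def doublings_first_def double_last_avoids_11_1
      flip: contains_11_1_rev)

lemma doublings_last_id: "\<not> contains_11_1 w \<Longrightarrow> doublings_last w = w"
  by (simp add: doublings_last_def double_last_shrink)

lemma doublings_first_id: "\<not> contains_1_11 w \<Longrightarrow> doublings_first w = w"
  by (simp add: doublings_first_def doublings_last_id contains_11_1_rev)

text \<open>
  Either map depends only on the shrunk word and the doubled letters, which the other one keeps;
  so the two maps are inverse to each other on the avoiders, their fixed points.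
\<close>

lemma doublings_last_first: "\<not> contains_11_1 w \<Longrightarrow> doublings_last (doublings_first w) = w"
  by (metis doublings_last_def doublings_last_id remdups_adj_doublings(2) doubled_doublings(2))

lemma doublings_first_last: "\<not> contains_1_11 w \<Longrightarrow> doublings_first (doublings_last w) = w"
  by (metis doublings_first_def doublings_last_def doublings_first_id remdups_adj_rev doubled_rev
      remdups_adj_doublings(1) doubled_doublings(1))

lemma length_doublings_first: "\<not> contains_11_1 w \<Longrightarrow> length (doublings_first w) = length w"
  by (metis doublings_last_id length_doublings)

lemma length_doublings_last: "\<not> contains_1_11 w \<Longrightarrow> length (doublings_last w) = length w"
  by (metis doublings_first_id length_doublings)


section \<open>Statistics of the shrunk word\<close>

lemma catalan_word_iff_successively:
  "catalan_word w \<longleftrightarrow>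
     w \<noteq> [] \<and> (\<forall>x \<in> set w. 1 \<le> x) \<and> hd w = 1 \<and> successively (\<lambda>a b. b \<le> a + 1) w"
  by (auto simp: catalan_word_def successively_conv_nth hd_conv_nth)

text \<open>A repeated letter never violates the bound on ascents, since \<open>a \<le> a + 1\<close>.\<close>

lemma catalan_word_remdups_adj: "catalan_word (remdups_adj w) \<longleftrightarrow> catalan_word w"
  by (simp add: catalan_word_iff_successively successively_remdups_adj_iff)

text \<open>
  Every statistic that ignores repetitions is equidistributed, because the bijection does not
  change the shrunk word.
\<close>

lemma card_avoiders_eq:
  assumes P: "\<And>w. P (remdups_adj w) \<longleftrightarrow> P w"
  shows "card {w \<in> catalan_avoiding contains_11_1 n. P w}
       = card {w \<in> catalan_avoiding contains_1_11 n. P w}"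
proof (rule bij_betw_same_card[of doublings_first],
    rule bij_betw_byWitness[where f' = doublings_last])
  have first: "catalan_word (doublings_first w) \<longleftrightarrow> catalan_word w"
    "P (doublings_first w) \<longleftrightarrow> P w" for w
    by (metis catalan_word_remdups_adj remdups_adj_doublings(2),
        metis P remdups_adj_doublings(2))
  have last: "catalan_word (doublings_last w) \<longleftrightarrow> catalan_word w"
    "P (doublings_last w) \<longleftrightarrow> P w" for w
    by (metis catalan_word_remdups_adj remdups_adj_doublings(1),
        metis P remdups_adj_doublings(1))
  let ?A = "{w \<in> catalan_avoiding contains_11_1 n. P w}"
  let ?B = "{w \<in> catalan_avoiding contains_1_11 n. P w}"
  show "\<forall>w \<in> ?A. doublings_last (doublings_first w) = w"
    by (simp add: catalan_avoiding_def doublings_last_first)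
  show "\<forall>w \<in> ?B. doublings_first (doublings_last w) = w"
    by (simp add: catalan_avoiding_def doublings_first_last)
  show "doublings_first ` ?A \<subseteq> ?B"
    by (auto simp: catalan_avoiding_def catalan_words_def doublings_avoid length_doublings_first
        first)
  show "doublings_last ` ?B \<subseteq> ?A"
    by (auto simp: catalan_avoiding_def catalan_words_def doublings_avoid length_doublings_last
        last)
qed

theorem proposition3p2:
  fixes n :: nat
  assumes "n \<ge> 1"
  shows "catalan_count contains_11_1 n = catalan_count contains_1_11 n \<and>
    (\<forall>k\<ge>1. card {w \<in> catalan_avoiding contains_11_1 n. Max (set w) = k}
           = card {w \<in> catalan_avoiding contains_1_11 n. Max (set w) = k}) \<and>
    (\<forall>k\<ge>1. card {w \<in> catalan_avoiding contains_11_1 n. last w = k}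
           = card {w \<in> catalan_avoiding contains_1_11 n. last w = k})"
proof (intro conjI allI impI)
  show "catalan_count contains_11_1 n = catalan_count contains_1_11 n"
    using card_avoiders_eq[of "\<lambda>_. True" n] by (simp add: catalan_count_def)
  fix k :: nat
  show "card {w \<in> catalan_avoiding contains_11_1 n. Max (set w) = k}
      = card {w \<in> catalan_avoiding contains_1_11 n. Max (set w) = k}"
    using card_avoiders_eq[of "\<lambda>w. Max (set w) = k" n] by simp
  show "card {w \<in> catalan_avoiding contains_11_1 n. last w = k}
      = card {w \<in> catalan_avoiding contains_1_11 n. last w = k}"
    using card_avoiders_eq[of "\<lambda>w. last w = k" n] by (simp add: last_remdups_adj)
qed

end
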